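(* Let $H\subseteq E(\mathscr{X})$ be nonempty, let $\mathcal{X}\subseteq\mathscr{X}$ be $H$-closed, and let $\pi_H\colon\mathcal{X}\to\mathscr{X}$ be the hyperedge addition/deletion partial transformation, i.e. $\pi_H(X)=X\boxplus H$ if $\bigcup H\subseteq V(X)$ and $\pi_H(X)=X$ if $\bigcup H\nsubseteq V(X)$. Define $$\mathcal{S}:=\{\,S\in\mathcal{X}\mid \textstyle\bigcup H\subseteq V(S)\text{ and }S=S\wedge H\,\},$$ and for $X\in\mathcal{X}$ define $\mathcal{D}_X:=\{X\wedge H\}$ if $\bigcup H\subseteq V(X)$ and $\mathcal{D}_X:=\emptyset$ if $\bigcup H\nsubseteq V(X)$. Then $\mathcal{T}_H:=(\mathcal{X},\pi_H,\mathcal{S})$ is a hypergraph transformation on $\mathscr{X}$ with $\mathcal{S}$-maximal subsets $\{\mathcal{D}_X\}_{X\in\mathcal{X}}$, and the collection of distinguished hypergraphs $\mathcal{S}$ is greatest for $\pi_H$ with respect to inclusion (among all collections $\mathcal{S}'\subseteq\mathcal{X}$ such that $(\mathcal{X},\pi_H,\mathcal{S}')$ is a hypergraph transformation on $\mathscr{X}$).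
   Context: Hypergraphs. Fix a nonempty set $L_V$ of vertices (vertices are identified with their labels) and a set $\mathbb{E}$ of labelled hyperedges: each $e\in\mathbb{E}$ has an underlying nonempty finite subset of $L_V$, also written $e$; every nonempty finite subset of $L_V$ (of size $\ge 2$ if loops are disallowed) underlies at least one and only finitely many elements of $\mathbb{E}$, so multiple hyperedges are allowed. Loops ($|e|=1$) are either allowed throughout or disallowed throughout. A hypergraph is a pair $X=(V(X),E(X))$ with $V(X)\subseteq L_V$ finite, $E(X)\subseteq\mathbb{E}$ finite, and $e\subseteq V(X)$ for all $e\in E(X)$. Let $\mathscr{X}$ be the set of all hypergraphs (the hypergraph family), $V(\mathscr{X})=L_V$, $E(\mathscr{X})=\mathbb{E}$, and let $\mathcal{N}$ be the null hypergraph (no vertices). A hypergraph is connected if it is nonnull and any two vertices are joined by a path; $\mathcal{C}(X)$ denotes the set of connected components of $X$ (maximal connected subhypergraphs), so $\mathcal{C}(\mathcal{N})=\emptyset$. $X,Y$ are (vertex) disjoint if $V(X)\cap V(Y)=\emptyset$, and component disjoint if $\mathcal{C}(X)\cap\mathcal{C}(Y)=\emptyset$. For pairwise disjoint hypergraphs, the direct sum $\bigoplus_i X_i$ has vertex set $\bigcup_i V(X_i)$ and hyperedge set $\bigcup_i E(X_i)$; the empty direct sum is $\mathcal{N}$. If $X=Y\oplus Z$ with $Y,Z$ disjoint, the direct difference is $X\ominus Z:=Y$ (it is defined exactly when $\mathcal{C}(Z)\subseteq\mathcal{C}(X)$). Component maximality. For $\mathcal{S}\subseteq\mathcal{X}\subseteq\mathscr{X}$,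 $\mathcal{S}$ is component maximal in $\mathcal{X}$ if for each $X\in\mathcal{X}$ there is a subset $\mathcal{D}_X\subseteq\mathcal{S}$, called an $\mathcal{S}$-maximal subset, such that: (1) $\mathcal{D}_X$ is pairwise component disjoint; (2) if $\mathcal{N}\in\mathcal{S}$ then $\mathcal{N}\in\mathcal{D}_X$; (3) $\mathcal{C}(T)\subseteq\mathcal{C}(X)$ for all $T\in\mathcal{D}_X$; (4) if $S\in\mathcal{S}$ and $\mathcal{C}(S)\subseteq\mathcal{C}(X)$ then there is $T\in\mathcal{D}_X$ with $\mathcal{C}(S)\subseteq\mathcal{C}(T)$. (Such $\mathcal{D}_X$ is unique.) Hypergraph transformation. A partial transformation on $\mathscr{X}$ is a map $\pi\colon\mathcal{X}\to\mathscr{X}$ with $\mathcal{X}\subseteq\mathscr{X}$. A hypergraph transformation on $\mathscr{X}$ is a triple $(\mathcal{X},\pi,\mathcal{S})$ with $\pi\colon\mathcal{X}\to\mathscr{X}$ a partial transformation and $\mathcal{S}\subseteq\mathcal{X}$ (the distinguished hypergraphs) such that: (1) $\mathcal{C}(S)\cap\mathcal{C}(\pi(S))=\emptyset$ for all $S\in\mathcal{S}$, and if $\mathcal{N}\in\mathcal{S}$ then $\pi(\mathcal{N})\ne\mathcal{N}$ (nonredundancy); (2) $\mathcal{S}$ is component maximal in $\mathcal{X}$, with $\mathcal{S}$-maximal subsets $\{\mathcal{D}_X\}_{X\in\mathcal{X}}$; (3) for each $X\in\mathcal{X}$, with $\mathcal{S}_X:=\{S\in\mathcal{D}_X\mid V(\pi(S))\cap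 V(X\ominus S)=\emptyset\}$, the set $\pi(\mathcal{S}_X)$ consists of pairwise vertex-disjoint hypergraphs, $|\pi(\mathcal{S}_X)|=|\mathcal{S}_X|$, and $\pi(X)=\overline{X}\oplus\bigoplus_{S\in\mathcal{S}_X}\pi(S)$ where $\overline{X}:=X\ominus\bigoplus_{S\in\mathcal{S}_X}S$. Hyperedge notation. For nonempty $H\subseteq E(\mathscr{X})$ and $X$ with $\bigcup H\subseteq V(X)$, $X\boxplus H$ is the hypergraph with vertex set $V(X)$ and hyperedge set the symmetric difference of $E(X)$ and $H$. For $H\subseteq E(\mathscr{X})$, $X\wedge H$ is the union of all $C\in\mathcal{C}(X)$ such that $e\cap V(C)\neq\emptyset$ for some $e\in H$. $\mathcal{X}$ is $H$-closed if $X\in\mathcal{X}$ and $\bigcup H\subseteq V(X)$ imply $X\wedge H\in\mathcal{X}$. *)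

theory Defs
  imports Main "HOL-Library.FuncSet"
begin

section \<open>Hypergraph families\<close>

text \<open>
  The ambient data: the vertex labels, the labelled hyperedges, and the map sending a labelled
  hyperedge to its underlying vertex set. The map need not be injective (multiple hyperedges).
\<close>

record ('v, 'e) family =
  vlabels :: "'v set"
  elabels :: "'e set"
  ends :: "'e \<Rightarrow> 'v set"

definition admissible :: "bool \<Rightarrow> 'v set \<Rightarrow> bool" where
  "admissible loops A \<longleftrightarrow> finite A \<and> A \<noteq> {} \<and> (\<not> loops \<longrightarrow> 2 \<le> card A)"

definition hypergraph_family :: "bool \<Rightarrow> ('v, 'e) family \<Rightarrow> bool" where
  "hypergraph_family loops F \<longleftrightarrow>
     vlabels F \<noteq> {} \<and>
     (\<forall>e \<in> elabels F. ends F e \<subseteq> vlabels F \<and> admissible loops (ends F e)) \<and>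
     (\<forall>A \<subseteq> vlabels F. admissible loops A \<longrightarrow>
        finite {e \<in> elabels F. ends F e = A} \<and> {e \<in> elabels F. ends F e = A} \<noteq> {})"

datatype ('v, 'e) hypergraph = Hypergraph (verts: "'v set") (hedges: "'e set")

definition hypergraphs :: "('v, 'e) family \<Rightarrow> ('v, 'e) hypergraph set" where
  "hypergraphs F =
     {X. verts X \<subseteq> vlabels F \<and> finite (verts X) \<and>
         hedges X \<subseteq> elabels F \<and> finite (hedges X) \<and>
         (\<forall>e \<in> hedges X. ends F e \<subseteq> verts X)}"

definition null :: "('v, 'e) hypergraph" where
  "null = Hypergraph {} {}"

definition subhypergraph :: "('v, 'e) hypergraph \<Rightarrow> ('v, 'e) hypergraph \<Rightarrow> bool" where
  "subhypergraph Y X \<longleftrightarrow> verts Y \<subseteq> verts X \<and> hedges Y \<subseteq> hedges X"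

section \<open>Connectedness and components\<close>

text \<open>
  A path is an alternating sequence of pairwise distinct vertices \<open>vs\<close> and pairwise distinct
  hyperedges \<open>es\<close>, the \<open>i\<close>-th hyperedge containing the \<open>i\<close>-th and the next vertex; the trivial
  path (\<open>es = []\<close>) joins a vertex to itself.
\<close>

definition hpath ::
  "('v, 'e) family \<Rightarrow> ('v, 'e) hypergraph \<Rightarrow> 'v list \<Rightarrow> 'e list \<Rightarrow> bool" where
  "hpath F X vs es \<longleftrightarrow>
     length vs = Suc (length es) \<and> distinct vs \<and> distinct es \<and>
     set vs \<subseteq> verts X \<and> set es \<subseteq> hedges X \<and>
     (\<forall>i < length es. vs ! i \<in> ends F (es ! i) \<and> vs ! Suc i \<in> ends F (es ! i))"

definition connected :: "('v, 'e) family \<Rightarrow> ('v, 'e) hypergraph \<Rightarrow> bool" where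
  "connected F X \<longleftrightarrow>
     X \<noteq> null \<and>
     (\<forall>u \<in> verts X. \<forall>v \<in> verts X. \<exists>vs es. hpath F X vs es \<and> hd vs = u \<and> last vs = v)"

definition components ::
  "('v, 'e) family \<Rightarrow> ('v, 'e) hypergraph \<Rightarrow> ('v, 'e) hypergraph set" where
  "components F X =
     {C \<in> hypergraphs F. subhypergraph C X \<and> connected F C \<and>
        (\<forall>D \<in> hypergraphs F.
           subhypergraph D X \<and> connected F D \<and> subhypergraph C D \<longrightarrow> D = C)}"

definition vdisjoint :: "('v, 'e) hypergraph \<Rightarrow> ('v, 'e) hypergraph \<Rightarrow> bool" where
  "vdisjoint X Y \<longleftrightarrow> verts X \<inter> verts Y = {}"

definition cdisjoint ::
  "('v, 'e) family \<Rightarrow> ('v, 'e) hypergraph \<Rightarrow> ('v, 'e) hypergraph \<Rightarrow> bool" where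
  "cdisjoint F X Y \<longleftrightarrow> components F X \<inter> components F Y = {}"

section \<open>Direct sums and differences\<close>

text \<open>
  The direct sum is the union, and is only meaningful for pairwise disjoint hypergraphs; wherever
  it is used as a direct sum below, disjointness is required separately or is a consequence of
  the surrounding conditions.
\<close>

definition hunion :: "('v, 'e) hypergraph set \<Rightarrow> ('v, 'e) hypergraph" where
  "hunion \<A> = Hypergraph (\<Union> (verts ` \<A>)) (\<Union> (hedges ` \<A>))"

definition is_direct_sum ::
  "('v, 'e) hypergraph \<Rightarrow> ('v, 'e) hypergraph \<Rightarrow> ('v, 'e) hypergraph \<Rightarrow> bool" where
  "is_direct_sum X Y Z \<longleftrightarrow> vdisjoint Y Z \<and> X = hunion {Y, Z}"

text \<open>
  \<open>Y\<close> is unique if it exists because hyperedges are nonempty, so that disjoint hypergraphs share no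
  hyperedge; the value is unspecified if there is no such \<open>Y\<close>.
\<close>

definition ddiff ::
  "('v, 'e) family \<Rightarrow> ('v, 'e) hypergraph \<Rightarrow> ('v, 'e) hypergraph \<Rightarrow> ('v, 'e) hypergraph" where
  "ddiff F X Z = (THE Y. Y \<in> hypergraphs F \<and> is_direct_sum X Y Z)"

section \<open>Component maximality\<close>

definition maximal_subset ::
  "('v, 'e) family \<Rightarrow> ('v, 'e) hypergraph set \<Rightarrow> ('v, 'e) hypergraph \<Rightarrow>
     ('v, 'e) hypergraph set \<Rightarrow> bool" where
  "maximal_subset F \<S> X D \<longleftrightarrow>
     D \<subseteq> \<S> \<and>
     pairwise (cdisjoint F) D \<and>
     (null \<in> \<S> \<longrightarrow> null \<in> D) \<and>
     (\<forall>T \<in> D. components F T \<subseteq> components F X) \<and>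
     (\<forall>S \<in> \<S>. components F S \<subseteq> components F X \<longrightarrow>
        (\<exists>T \<in> D. components F S \<subseteq> components F T))"

definition component_maximal ::
  "('v, 'e) family \<Rightarrow> ('v, 'e) hypergraph set \<Rightarrow> ('v, 'e) hypergraph set \<Rightarrow>
     (('v, 'e) hypergraph \<Rightarrow> ('v, 'e) hypergraph set) \<Rightarrow> bool" where
  "component_maximal F \<S> \<X> \<D> \<longleftrightarrow> (\<forall>X \<in> \<X>. maximal_subset F \<S> X (\<D> X))"

section \<open>Hypergraph transformations\<close>

text \<open>
  A partial transformation with domain \<open>\<X>\<close> is represented by a total function of which only the
  values on \<open>\<X>\<close> are ever used.
\<close>

definition replaced ::
  "('v, 'e) family \<Rightarrow> (('v, 'e) hypergraph \<Rightarrow> ('v, 'e) hypergraph) \<Rightarrow>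
     ('v, 'e) hypergraph set \<Rightarrow> ('v, 'e) hypergraph \<Rightarrow> ('v, 'e) hypergraph set" where
  "replaced F \<pi> D X = {S \<in> D. verts (\<pi> S) \<inter> verts (ddiff F X S) = {}}"

text \<open>
  The sets \<open>replaced F \<pi> (\<D> X) X\<close> below are automatically finite, their members being determined by
  their components, which lie in the finite set \<open>components F X\<close>; so the cardinality condition has
  its usual meaning.
\<close>

definition hypergraph_transformation_with ::
  "('v, 'e) family \<Rightarrow> ('v, 'e) hypergraph set \<Rightarrow>
     (('v, 'e) hypergraph \<Rightarrow> ('v, 'e) hypergraph) \<Rightarrow> ('v, 'e) hypergraph set \<Rightarrow>
     (('v, 'e) hypergraph \<Rightarrow> ('v, 'e) hypergraph set) \<Rightarrow> bool" where
  "hypergraph_transformation_with F \<X> \<pi> \<S> \<D> \<longleftrightarrow>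
     \<X> \<subseteq> hypergraphs F \<and> \<pi> \<in> \<X> \<rightarrow> hypergraphs F \<and> \<S> \<subseteq> \<X> \<and>
     (\<forall>S \<in> \<S>. cdisjoint F S (\<pi> S)) \<and> (null \<in> \<S> \<longrightarrow> \<pi> null \<noteq> null) \<and>
     component_maximal F \<S> \<X> \<D> \<and>
     (\<forall>X \<in> \<X>. let R = replaced F \<pi> (\<D> X) X in
        pairwise vdisjoint (\<pi> ` R) \<and> card (\<pi> ` R) = card R \<and>
        is_direct_sum (\<pi> X) (ddiff F X (hunion R)) (hunion (\<pi> ` R)))"

definition hypergraph_transformation ::
  "('v, 'e) family \<Rightarrow> ('v, 'e) hypergraph set \<Rightarrow>
     (('v, 'e) hypergraph \<Rightarrow> ('v, 'e) hypergraph) \<Rightarrow> ('v, 'e) hypergraph set \<Rightarrow> bool" where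
  "hypergraph_transformation F \<X> \<pi> \<S> \<longleftrightarrow>
     (\<exists>\<D>. hypergraph_transformation_with F \<X> \<pi> \<S> \<D>)"

section \<open>Hyperedge addition and deletion\<close>

abbreviation supp :: "('v, 'e) family \<Rightarrow> 'e set \<Rightarrow> 'v set" where
  "supp F H \<equiv> \<Union> (ends F ` H)"

definition boxplus :: "('v, 'e) hypergraph \<Rightarrow> 'e set \<Rightarrow> ('v, 'e) hypergraph" where
  "boxplus X H = Hypergraph (verts X) ((hedges X - H) \<union> (H - hedges X))"

definition wedge ::
  "('v, 'e) family \<Rightarrow> ('v, 'e) hypergraph \<Rightarrow> 'e set \<Rightarrow> ('v, 'e) hypergraph" where
  "wedge F X H = hunion {C \<in> components F X. \<exists>e \<in> H. ends F e \<inter> verts C \<noteq> {}}"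

definition H_closed ::
  "('v, 'e) family \<Rightarrow> 'e set \<Rightarrow> ('v, 'e) hypergraph set \<Rightarrow> bool" where
  "H_closed F H \<X> \<longleftrightarrow> (\<forall>X \<in> \<X>. supp F H \<subseteq> verts X \<longrightarrow> wedge F X H \<in> \<X>)"

end

theory Submission
  imports Defs
begin

text \<open>
  Write \<open>W\<close> for \<open>wedge F X H\<close>. Everything rests on one observation about a hypergraph \<open>X\<close> whose
  vertices include those of \<open>H\<close>: a component of \<open>X\<close> is still a component of \<open>boxplus X H\<close> exactly
  when no hyperedge of \<open>H\<close> meets it (\<open>components_boxplus\<close>). A hyperedge \<open>e\<close> of \<open>H\<close> that meets a
  component \<open>C\<close> is either an edge of \<open>C\<close> that is deleted, or a new edge that touches \<open>C\<close> without
  belonging to it; both destroy \<open>C\<close>. So \<open>boxplus\<close> replaces \<open>W\<close>, the union of the components met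
  by \<open>H\<close>, and leaves the rest alone.

  For \<open>\<S>\<close> to be a legitimate set of distinguished hypergraphs it remains to see that \<open>W\<close> belongs to
  \<open>\<S>\<close> (it lies in \<open>\<X>\<close> because \<open>\<X>\<close> is \<open>H\<close>-closed), that it contains every member of
  \<open>\<S>\<close> made of components of \<open>X\<close> (the components of such a member all meet
  \<open>H\<close>), and that \<open>boxplus X H\<close> is the direct sum of the remainder of \<open>X\<close> and
  \<open>boxplus W H\<close>. If \<open>X\<close> does not contain all vertices of \<open>H\<close>, then no member of \<open>\<S>\<close> is made of
  components of \<open>X\<close>, and nothing is replaced.

  That \<open>\<S>\<close> is greatest comes from nonredundancy: a distinguished \<open>S\<close> shares no component with its
  image. If \<open>S\<close> were fixed, it would have no component, hence be null, which nonredundancy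
  also excludes; so \<open>S\<close> contains all vertices of \<open>H\<close>. By the observation, every component of \<open>S\<close>
  then meets \<open>H\<close>, which says that \<open>S = wedge F S H\<close>.

  The facts about components come from replacing paths by closed vertex sets
  (\<open>connected_iff_closed\<close>) and from recognising a component as a connected direct summand
  (\<open>components_iff_summand\<close>), a condition that is local at each hyperedge and so can be compared
  between different ambient hypergraphs.
\<close>

section \<open>Hypergraphs of a family\<close>

lemma ends_nonempty:
  "hypergraph_family loops F \<Longrightarrow> e \<in> elabels F \<Longrightarrow> ends F e \<noteq> {}"
  by (auto simp: hypergraph_family_def admissible_def)

lemma null_iff_verts_empty:
  assumes "hypergraph_family loops F" "X \<in> hypergraphs F"
  shows "X = null \<longleftrightarrow> verts X = {}"
proof
  assume V: "verts X = {}"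
  have "hedges X = {}"
  proof (rule ccontr)
    assume "hedges X \<noteq> {}"
    then obtain e where "e \<in> hedges X" by blast
    then have "e \<in> elabels F" "ends F e \<subseteq> {}" using assms(2) V by (auto simp: hypergraphs_def)
    then show False using ends_nonempty[OF assms(1)] by blast
  qed
  then show "X = null" using V by (cases X) (simp add: null_def)
qed (simp add: null_def)

lemma subhypergraph_in_hypergraphs:
  assumes X: "X \<in> hypergraphs F" and Y: "subhypergraph Y X"
    and ends: "\<And>e. e \<in> hedges Y \<Longrightarrow> ends F e \<subseteq> verts Y"
  shows "Y \<in> hypergraphs F"
proof -
  have sub: "verts Y \<subseteq> verts X" "hedges Y \<subseteq> hedges X" using Y by (simp_all add: subhypergraph_def)
  have "finite (verts X)" "finite (hedges X)" using X by (simp_all add: hypergraphs_def)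
  then have "finite (verts Y)" "finite (hedges Y)" using sub by (simp_all add: finite_subset)
  moreover have "verts Y \<subseteq> vlabels F" "hedges Y \<subseteq> elabels F"
    using X sub by (simp_all add: hypergraphs_def subset_trans)
  ultimately show ?thesis using ends by (simp add: hypergraphs_def)
qed

section \<open>Connectedness by closed vertex sets\<close>

definition edge_closed :: "('v, 'e) family \<Rightarrow> ('v, 'e) hypergraph \<Rightarrow> 'v set \<Rightarrow> bool" where
  "edge_closed F X U \<longleftrightarrow> (\<forall>e \<in> hedges X. ends F e \<inter> U \<noteq> {} \<longrightarrow> ends F e \<subseteq> U)"

lemma hpath_edge_closed:
  assumes "hpath F X vs es" "edge_closed F X U" "hd vs \<in> U"
  shows "set vs \<subseteq> U"
proof -
  have "vs ! i \<in> U" if "i < length vs" for i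
    using that
  proof (induction i)
    case 0
    then show ?case using assms(3) by (simp add: hd_conv_nth)
  next
    case (Suc i)
    then have "i < length es" using assms(1) by (simp add: hpath_def)
    then have "es ! i \<in> hedges X" "vs ! i \<in> ends F (es ! i)" "vs ! Suc i \<in> ends F (es ! i)"
      using assms(1) by (auto simp: hpath_def)
    then show ?case using Suc assms(2) unfolding edge_closed_def by auto
  qed
  then show ?thesis by (auto simp: in_set_conv_nth)
qed

lemma hpath_prefix:
  assumes "hpath F X vs es" "i < length vs"
  shows "hpath F X (take (Suc i) vs) (take i es)"
    and "hd (take (Suc i) vs) = hd vs" and "last (take (Suc i) vs) = vs ! i"
proof -
  show "hpath F X (take (Suc i) vs) (take i es)"
    using assms set_take_subset[of "Suc i" vs] set_take_subset[of i es]
    by (auto simp: hpath_def)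
  show "hd (take (Suc i) vs) = hd vs" by simp
  show "last (take (Suc i) vs) = vs ! i" using assms(2) by (simp add: take_Suc_conv_app_nth)
qed

text \<open>
  Appending \<open>e\<close> and \<open>w\<close> at the end of the given path might repeat a vertex or a hyperedge. A repeated
  vertex \<open>w\<close> is avoided by stopping at it; a repeated hyperedge is avoided by leaving the path at
  its first vertex on \<open>e\<close>, because no earlier step can have used \<open>e\<close>.
\<close>
lemma hpath_extend:
  assumes p: "hpath F X vs es" and e: "e \<in> hedges X" "last vs \<in> ends F e" "w \<in> ends F e"
    and w: "w \<in> verts X"
  shows "\<exists>vs' es'. hpath F X vs' es' \<and> hd vs' = hd vs \<and> last vs' = w"
proof (cases "w \<in> set vs")
  case True
  then obtain i where "i < length vs" "vs ! i = w" by (auto simp: in_set_conv_nth)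
  then show ?thesis using hpath_prefix[OF p] by metis
next
  case False
  define i where "i = (LEAST i. vs ! i \<in> ends F e)"
  have len: "length vs = Suc (length es)" using p by (simp add: hpath_def)
  then have l: "vs ! length es \<in> ends F e" using e(2) last_conv_nth[of vs] by fastforce
  have i: "vs ! i \<in> ends F e" unfolding i_def by (rule LeastI[of "\<lambda>i. vs ! i \<in> ends F e", OF l])
  have "i \<le> length es" unfolding i_def by (rule Least_le[of "\<lambda>i. vs ! i \<in> ends F e", OF l])
  have min: "vs ! j \<notin> ends F e" if "j < i" for j using that not_less_Least unfolding i_def by blast
  let ?vs = "take (Suc i) vs" and ?es = "take i es"
  have pre: "hpath F X ?vs ?es" using hpath_prefix[OF p] len \<open>i \<le> length es\<close> by simp
  have lens: "length ?vs = Suc i" "length ?es = i" using len \<open>i \<le> length es\<close> by auto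
  have new_e: "e \<notin> set ?es"
  proof
    assume "e \<in> set ?es"
    then obtain j where "j < i" "es ! j = e" using lens by (auto simp: in_set_conv_nth)
    moreover have "vs ! j \<in> ends F (es ! j)"
      using p \<open>j < i\<close> \<open>i \<le> length es\<close> by (simp add: hpath_def)
    ultimately show False using min by blast
  qed
  have new_w: "w \<notin> set ?vs" using False by (meson in_set_takeD)
  have step: "(?vs @ [w]) ! j \<in> ends F ((?es @ [e]) ! j) \<and>
      (?vs @ [w]) ! Suc j \<in> ends F ((?es @ [e]) ! j)" if "j < Suc i" for j
  proof (cases "j = i")
    case True
    then show ?thesis using lens i e(3) by (auto simp: nth_append)
  next
    case False
    then have "j < i" using that by simp
    then show ?thesis using pre lens by (auto simp: nth_append hpath_def)
  qed
  have "\<forall>j < length (?es @ [e]). (?vs @ [w]) ! j \<in> ends F ((?es @ [e]) ! j) \<and>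
      (?vs @ [w]) ! Suc j \<in> ends F ((?es @ [e]) ! j)"
    using step lens(2) by (metis Suc_eq_plus1 length_append_singleton)
  moreover have "length (?vs @ [w]) = Suc (length (?es @ [e]))" using lens by simp
  moreover have "distinct (?vs @ [w])" "distinct (?es @ [e])"
    "set (?vs @ [w]) \<subseteq> verts X" "set (?es @ [e]) \<subseteq> hedges X"
    using pre new_e new_w e(1) w by (simp_all add: hpath_def)
  ultimately have "hpath F X (?vs @ [w]) (?es @ [e])" unfolding hpath_def by blast
  moreover have "hd (?vs @ [w]) = hd vs" using len by (cases vs) auto
  ultimately show ?thesis by (metis last_snoc)
qed

lemma connected_iff_closed:
  assumes X: "X \<in> hypergraphs F"
  shows "connected F X \<longleftrightarrow>
    X \<noteq> null \<and> (\<forall>U \<subseteq> verts X. U \<noteq> {} \<and> edge_closed F X U \<longrightarrow> U = verts X)"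
    (is "_ \<longleftrightarrow> _ \<and> ?R")
proof (intro iffI conjI)
  assume con: "connected F X"
  show "X \<noteq> null" using con unfolding connected_def by (rule conjunct1)
  show ?R
  proof (intro allI impI; elim conjE)
    fix U assume U: "U \<subseteq> verts X" "U \<noteq> {}" "edge_closed F X U"
    then obtain u where u: "u \<in> U" by auto
    have "v \<in> U" if "v \<in> verts X" for v
    proof -
      have "u \<in> verts X" using u U(1) by blast
      then have "\<exists>vs es. hpath F X vs es \<and> hd vs = u \<and> last vs = v"
        using con that by (simp add: connected_def)
      then obtain vs es where p: "hpath F X vs es" "hd vs = u" "last vs = v" by blast
      have "hd vs \<in> U" using p(2) u by simp
      then have "set vs \<subseteq> U" by (rule hpath_edge_closed[OF p(1) U(3)])
      moreover have "last vs \<in> set vs" using p(1) by (intro last_in_set) (auto simp: hpath_def)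
      ultimately show ?thesis using p(3) by blast
    qed
    then show "U = verts X" using U(1) by blast
  qed
next
  assume r: "X \<noteq> null \<and> ?R"
  have reach: "\<exists>vs es. hpath F X vs es \<and> hd vs = u \<and> last vs = v"
    if "u \<in> verts X" "v \<in> verts X" for u v
  proof -
    let ?U = "{v \<in> verts X. \<exists>vs es. hpath F X vs es \<and> hd vs = u \<and> last vs = v}"
    have "hpath F X [u] [] \<and> hd [u] = u \<and> last [u] = u" using that by (simp add: hpath_def)
    then have "u \<in> ?U" using that(1) by blast
    moreover have "edge_closed F X ?U"
      unfolding edge_closed_def
    proof (intro ballI impI subsetI)
      fix e w assume e: "e \<in> hedges X" "ends F e \<inter> ?U \<noteq> {}" and w: "w \<in> ends F e"
      then obtain vs es where p: "hpath F X vs es" "hd vs = u" "last vs \<in> ends F e" by blast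
      have "w \<in> verts X" using e w X by (auto simp: hypergraphs_def)
      then show "w \<in> ?U" using hpath_extend[OF p(1) e(1) p(3) w] p(2) by blast
    qed
    moreover have "?U \<subseteq> verts X" by blast
    ultimately have "?U = verts X" using conjunct2[OF r, rule_format, of ?U] by blast
    then show ?thesis using that by blast
  qed
  show "connected F X"
    unfolding connected_def by (intro conjI ballI reach conjunct1[OF r])
qed

section \<open>Components as connected direct summands\<close>

text \<open>
  A union of components of \<open>X\<close> is described without mentioning components: it absorbs every
  hyperedge of \<open>X\<close> that it touches.
\<close>
definition summand ::
  "('v, 'e) family \<Rightarrow> ('v, 'e) hypergraph \<Rightarrow> ('v, 'e) hypergraph \<Rightarrow> bool" where
  "summand F Y X \<longleftrightarrow> Y \<in> hypergraphs F \<and> subhypergraph Y X \<and>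
     (\<forall>e \<in> hedges X. ends F e \<inter> verts Y \<noteq> {} \<longrightarrow> e \<in> hedges Y)"

text \<open>
  A hyperedge that touches a component without belonging to it could be added to it; conversely,
  inside a larger connected subhypergraph the vertices of a summand form a closed set.
\<close>
lemma components_iff_summand:
  assumes F: "hypergraph_family loops F" and X: "X \<in> hypergraphs F"
  shows "C \<in> components F X \<longleftrightarrow> connected F C \<and> summand F C X"
proof (intro iffI conjI)
  assume C: "C \<in> components F X"
  then show con: "connected F C" by (simp add: components_def)
  have hC: "C \<in> hypergraphs F" "subhypergraph C X"
    and max: "\<And>D. D \<in> hypergraphs F \<Longrightarrow> subhypergraph D X \<Longrightarrow> connected F D \<Longrightarrow>
      subhypergraph C D \<Longrightarrow> D = C"
    using C by (auto simp: components_def)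
  have "e \<in> hedges C" if e: "e \<in> hedges X" "ends F e \<inter> verts C \<noteq> {}" for e
  proof -
    let ?D = "Hypergraph (verts C \<union> ends F e) (insert e (hedges C))"
    have e_X: "ends F e \<subseteq> verts X" "verts X \<subseteq> vlabels F" "finite (verts X)" "e \<in> elabels F"
      using X e(1) by (auto simp: hypergraphs_def)
    have "finite (ends F e)" by (rule finite_subset[OF e_X(1,3)])
    then have D: "?D \<in> hypergraphs F" using hC(1) e_X by (auto simp: hypergraphs_def)
    have sD: "subhypergraph ?D X" "subhypergraph C ?D"
      using hC(2) X e(1) by (auto simp: subhypergraph_def hypergraphs_def)
    have "U = verts ?D" if U: "U \<subseteq> verts ?D" "U \<noteq> {}" "edge_closed F ?D U" for U
    proof -
      have meets: "U \<inter> verts C \<noteq> {}" using U e(2) by (auto simp: edge_closed_def)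
      have "edge_closed F C (U \<inter> verts C)"
        using U(3) hC(1) unfolding edge_closed_def hypergraphs_def by auto
      then have "verts C \<subseteq> U"
        using meets con hC(1) by (metis connected_iff_closed inf_le1 inf_le2)
      then show ?thesis using U e(2) by (auto simp: edge_closed_def)
    qed
    then have "connected F ?D"
      using D e(2) by (subst connected_iff_closed) (auto simp: null_def)
    then have "?D = C" using max D sD by blast
    then show ?thesis by (metis hypergraph.sel(2) insertI1)
  qed
  then show "summand F C X" using hC by (simp add: summand_def)
next
  assume "connected F C \<and> summand F C X"
  then have con: "connected F C" and C: "C \<in> hypergraphs F" "subhypergraph C X"
    and closed: "\<And>e. e \<in> hedges X \<Longrightarrow> ends F e \<inter> verts C \<noteq> {} \<Longrightarrow> e \<in> hedges C"
    by (auto simp: summand_def)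
  have "verts C \<noteq> {}" using con null_iff_verts_empty[OF F C(1)] by (simp add: connected_def)
  have "D = C" if D: "D \<in> hypergraphs F" "subhypergraph D X" "connected F D" "subhypergraph C D"
    for D
  proof -
    have "edge_closed F D (verts C)"
      using D(2) closed C(1) unfolding edge_closed_def subhypergraph_def hypergraphs_def by blast
    then have v: "verts C = verts D"
      using D connected_iff_closed[OF D(1)] \<open>verts C \<noteq> {}\<close> by (simp add: subhypergraph_def)
    have "e \<in> hedges C" if "e \<in> hedges D" for e
    proof -
      have "ends F e \<subseteq> verts C" "ends F e \<noteq> {}" "e \<in> hedges X"
        using that v D ends_nonempty[OF F] by (auto simp: hypergraphs_def subhypergraph_def)
      then show ?thesis using closed by blast
    qed
    then show ?thesis using v D(4) by (cases C, cases D) (auto simp: subhypergraph_def)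
  qed
  then show "C \<in> components F X" using con C by (simp add: components_def)
qed

lemma component_verts_nonempty:
  assumes "hypergraph_family loops F" "C \<in> components F X"
  shows "verts C \<noteq> {}"
  using assms null_iff_verts_empty[OF assms(1)] by (auto simp: components_def connected_def)

lemma components_share_vertex:
  assumes F: "hypergraph_family loops F" and X: "X \<in> hypergraphs F"
    and C: "C \<in> components F X" and D: "D \<in> components F X" and meet: "verts C \<inter> verts D \<noteq> {}"
  shows "C = D"
proof -
  have sub: "verts A \<subseteq> verts B"
    if A: "A \<in> components F X" and B: "B \<in> components F X" and m: "verts A \<inter> verts B \<noteq> {}" for A B
  proof -
    have con: "connected F A" and sA: "summand F A X" and sB: "summand F B X"
      using A B components_iff_summand[OF F X] by auto
    have "edge_closed F A (verts A \<inter> verts B)"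
      unfolding edge_closed_def
    proof (intro ballI impI)
      fix e assume e: "e \<in> hedges A" "ends F e \<inter> (verts A \<inter> verts B) \<noteq> {}"
      then have "e \<in> hedges X" "ends F e \<subseteq> verts A"
        using sA by (auto simp: summand_def subhypergraph_def hypergraphs_def)
      moreover from this(1) have "e \<in> hedges B" using sB e(2) by (auto simp: summand_def)
      then have "ends F e \<subseteq> verts B" using sB by (simp add: summand_def hypergraphs_def)
      ultimately show "ends F e \<subseteq> verts A \<inter> verts B" by blast
    qed
    then have "verts A \<inter> verts B = verts A"
      using con m sA connected_iff_closed[of A F] by (auto simp: summand_def)
    then show ?thesis by blast
  qed
  have v: "verts C = verts D" using sub[OF C D] sub[OF D C] meet by blast
  have sC: "summand F C X" and sD: "summand F D X"
    using C D components_iff_summand[OF F X] by auto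
  have "e \<in> hedges B"
    if "e \<in> hedges A" "summand F A X" "summand F B X" "verts A = verts B" for e A B
  proof -
    have "e \<in> elabels F" "ends F e \<subseteq> verts B" "e \<in> hedges X"
      using that by (auto simp: summand_def hypergraphs_def subhypergraph_def)
    then show ?thesis using that ends_nonempty[OF F] unfolding summand_def by blast
  qed
  then have "hedges C = hedges D" using sC sD v by blast
  then show ?thesis using v by (simp add: hypergraph.expand)
qed

text \<open>
  The component of \<open>v\<close> is carried by the least closed set \<open>K\<close> containing \<open>v\<close>. It is connected
  because a closed \<open>U \<subseteq> K\<close> that misses \<open>v\<close> would leave a smaller closed set \<open>K - U\<close>.
\<close>
lemma vertex_in_component:
  assumes F: "hypergraph_family loops F" and X: "X \<in> hypergraphs F" and v: "v \<in> verts X"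
  obtains C where "C \<in> components F X" "v \<in> verts C"
proof -
  define K where "K = \<Inter> {U. v \<in> U \<and> edge_closed F X U}"
  define C where "C = Hypergraph K {e \<in> hedges X. ends F e \<subseteq> K}"
  have least: "K \<subseteq> U" if "v \<in> U" "edge_closed F X U" for U using that by (auto simp: K_def)
  have "v \<in> K" by (simp add: K_def)
  have closed: "edge_closed F X K" unfolding K_def edge_closed_def by blast
  have "edge_closed F X (verts X)" using X by (auto simp: edge_closed_def hypergraphs_def)
  then have "K \<subseteq> verts X" using least v by blast
  then have sub: "subhypergraph C X" by (auto simp: C_def subhypergraph_def)
  have C: "C \<in> hypergraphs F"
    by (rule subhypergraph_in_hypergraphs[OF X sub]) (simp add: C_def)
  have "U = K" if U: "U \<subseteq> K" "U \<noteq> {}" "edge_closed F C U" for U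
  proof -
    have UX: "edge_closed F X U"
      unfolding edge_closed_def
    proof (intro ballI impI)
      fix e assume e: "e \<in> hedges X" "ends F e \<inter> U \<noteq> {}"
      then have "ends F e \<inter> K \<noteq> {}" using U(1) by blast
      then have "e \<in> hedges C" using closed e(1) by (simp add: edge_closed_def C_def)
      then show "ends F e \<subseteq> U" using U(3) e(2) by (simp add: edge_closed_def)
    qed
    show ?thesis
    proof (cases "v \<in> U")
      case True
      then show ?thesis using least[OF True UX] U(1) by blast
    next
      case False
      have "edge_closed F X (K - U)" using UX closed unfolding edge_closed_def by blast
      then have "K \<subseteq> K - U" using least False \<open>v \<in> K\<close> by blast
      then show ?thesis using U by blast
    qed
  qed
  then have "connected F C"
    using C \<open>v \<in> K\<close> by (subst connected_iff_closed) (auto simp: C_def null_def)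
  moreover have "summand F C X"
    using C sub closed by (simp add: summand_def C_def edge_closed_def)
  ultimately show ?thesis
    using that components_iff_summand[OF F X] \<open>v \<in> K\<close> by (auto simp: C_def)
qed

lemma verts_mono_components:
  assumes F: "hypergraph_family loops F" and Y: "Y \<in> hypergraphs F"
    and sub: "components F Y \<subseteq> components F X"
  shows "verts Y \<subseteq> verts X"
proof
  fix v assume "v \<in> verts Y"
  then obtain C where "C \<in> components F Y" "v \<in> verts C" using vertex_in_component[OF F Y] by blast
  then show "v \<in> verts X" using sub by (auto simp: components_def subhypergraph_def)
qed

section \<open>Direct differences\<close>

lemma ddiff_summand:
  assumes F: "hypergraph_family loops F" and X: "X \<in> hypergraphs F" and Z: "summand F Z X"
  shows "ddiff F X Z = Hypergraph (verts X - verts Z) (hedges X - hedges Z)"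
  unfolding ddiff_def
proof (rule the_equality)
  let ?Y = "Hypergraph (verts X - verts Z) (hedges X - hedges Z)"
  have "?Y \<in> hypergraphs F"
  proof (rule subhypergraph_in_hypergraphs[OF X])
    fix e assume "e \<in> hedges ?Y"
    then have "e \<in> hedges X" "e \<notin> hedges Z" by auto
    then have "ends F e \<subseteq> verts X" "ends F e \<inter> verts Z = {}"
      using X Z by (auto simp: hypergraphs_def summand_def)
    then show "ends F e \<subseteq> verts ?Y" by auto
  qed (auto simp: subhypergraph_def)
  moreover have "is_direct_sum X ?Y Z"
  proof -
    have "verts Z \<subseteq> verts X" "hedges Z \<subseteq> hedges X"
      using Z by (simp_all add: summand_def subhypergraph_def)
    then show ?thesis by (cases X) (auto simp: is_direct_sum_def vdisjoint_def hunion_def)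
  qed
  ultimately show "?Y \<in> hypergraphs F \<and> is_direct_sum X ?Y Z" by blast
next
  fix Y assume "Y \<in> hypergraphs F \<and> is_direct_sum X Y Z"
  then have Y: "Y \<in> hypergraphs F" "verts Y \<inter> verts Z = {}" "X = hunion {Y, Z}"
    by (auto simp: is_direct_sum_def vdisjoint_def)
  have "hedges Y \<inter> hedges Z = {}"
  proof (rule ccontr)
    assume "hedges Y \<inter> hedges Z \<noteq> {}"
    then obtain e where "e \<in> hedges Y" "e \<in> hedges Z" by blast
    then have "ends F e \<subseteq> verts Y \<inter> verts Z" "ends F e \<noteq> {}"
      using Y(1) Z ends_nonempty[OF F] by (auto simp: hypergraphs_def summand_def)
    then show False using Y(2) by blast
  qed
  then show "Y = Hypergraph (verts X - verts Z) (hedges X - hedges Z)"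
    using Y(2,3) by (cases Y) (auto simp: hunion_def)
qed

lemma null_summand: "summand F null X"
  by (simp add: summand_def null_def hypergraphs_def subhypergraph_def)

section \<open>The part of a hypergraph met by a set of hyperedges\<close>

lemma wedge_summand:
  assumes F: "hypergraph_family loops F" and X: "X \<in> hypergraphs F"
  shows "summand F (wedge F X H) X"
proof -
  let ?W = "wedge F X H"
  have comp: "summand F C X" if "C \<in> components F X" for C
    using that components_iff_summand[OF F X] by blast
  have part: "verts C \<subseteq> verts X" "hedges C \<subseteq> hedges X" if "C \<in> components F X" for C
    using comp[OF that] by (simp_all add: summand_def subhypergraph_def)
  have sub: "subhypergraph ?W X"
    unfolding subhypergraph_def wedge_def hunion_def hypergraph.sel using part by blast
  have "ends F e \<subseteq> verts ?W" if e: "e \<in> hedges ?W" for e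
  proof -
    obtain C where C: "C \<in> components F X" "\<exists>e \<in> H. ends F e \<inter> verts C \<noteq> {}" "e \<in> hedges C"
      using e by (auto simp: wedge_def hunion_def)
    then have "ends F e \<subseteq> verts C" using comp[OF C(1)] by (simp add: summand_def hypergraphs_def)
    then show ?thesis using C by (auto simp: wedge_def hunion_def)
  qed
  then have "?W \<in> hypergraphs F" by (rule subhypergraph_in_hypergraphs[OF X sub])
  moreover have "e \<in> hedges ?W" if e: "e \<in> hedges X" "ends F e \<inter> verts ?W \<noteq> {}" for e
  proof -
    obtain C where C: "C \<in> components F X" "\<exists>e \<in> H. ends F e \<inter> verts C \<noteq> {}"
      "ends F e \<inter> verts C \<noteq> {}"
      using e(2) by (auto simp: wedge_def hunion_def)
    then have "e \<in> hedges C" using comp[OF C(1)] e(1) by (simp add: summand_def)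
    then show ?thesis using C(1,2) by (auto simp: wedge_def hunion_def)
  qed
  ultimately show ?thesis using sub by (simp add: summand_def)
qed

lemma components_wedge:
  assumes F: "hypergraph_family loops F" and X: "X \<in> hypergraphs F"
  shows "components F (wedge F X H) =
    {C \<in> components F X. \<exists>e \<in> H. ends F e \<inter> verts C \<noteq> {}}" (is "_ = ?R")
proof
  have W: "summand F (wedge F X H) X" by (rule wedge_summand[OF F X])
  then have hW: "wedge F X H \<in> hypergraphs F" by (simp add: summand_def)
  show "components F (wedge F X H) \<subseteq> ?R"
  proof
    fix C assume C: "C \<in> components F (wedge F X H)"
    then have "connected F C" and CW: "summand F C (wedge F X H)"
      using components_iff_summand[OF F hW] by auto
    moreover have "summand F C X"
      using CW W unfolding summand_def subhypergraph_def by blast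
    ultimately have CX: "C \<in> components F X" using components_iff_summand[OF F X] by blast
    obtain v where v: "v \<in> verts C" using component_verts_nonempty[OF F C] by blast
    then have "v \<in> verts (wedge F X H)" using CW by (auto simp: summand_def subhypergraph_def)
    then obtain D where "D \<in> ?R" "v \<in> verts D" by (auto simp: wedge_def hunion_def)
    then show "C \<in> ?R" using components_share_vertex[OF F X CX] v by blast
  qed
  show "?R \<subseteq> components F (wedge F X H)"
  proof
    fix C assume C: "C \<in> ?R"
    then have "connected F C" and CX: "summand F C X" using components_iff_summand[OF F X] by auto
    moreover have "subhypergraph C (wedge F X H)"
      using C by (auto simp: subhypergraph_def wedge_def hunion_def)
    then have "summand F C (wedge F X H)"
      using CX W unfolding summand_def subhypergraph_def by blast
    ultimately show "C \<in> components F (wedge F X H)"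
      using components_iff_summand[OF F hW] by blast
  qed
qed

lemma supp_subset_wedge:
  assumes F: "hypergraph_family loops F" and X: "X \<in> hypergraphs F"
    and sup: "supp F H \<subseteq> verts X"
  shows "supp F H \<subseteq> verts (wedge F X H)"
proof
  fix v assume "v \<in> supp F H"
  then obtain e where e: "e \<in> H" "v \<in> ends F e" by blast
  then obtain C where "C \<in> components F X" "v \<in> verts C"
    using vertex_in_component[OF F X] sup by blast
  then show "v \<in> verts (wedge F X H)" using e by (auto simp: wedge_def hunion_def)
qed

lemma wedge_wedge:
  assumes F: "hypergraph_family loops F" and X: "X \<in> hypergraphs F"
  shows "wedge F (wedge F X H) H = wedge F X H"
  by (simp add: wedge_def[of F "wedge F X H"] components_wedge[OF F X]) (simp add: wedge_def)

text \<open>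
  If \<open>H\<close> meets every component, then \<open>wedge\<close> omits no vertex and, being a summand, omits no
  hyperedge either.
\<close>
lemma wedge_eq_self_iff:
  assumes F: "hypergraph_family loops F" and X: "X \<in> hypergraphs F"
  shows "X = wedge F X H \<longleftrightarrow> (\<forall>C \<in> components F X. \<exists>e \<in> H. ends F e \<inter> verts C \<noteq> {})"
proof
  assume "X = wedge F X H"
  then show "\<forall>C \<in> components F X. \<exists>e \<in> H. ends F e \<inter> verts C \<noteq> {}"
    using components_wedge[OF F X, of H] by auto
next
  assume all: "\<forall>C \<in> components F X. \<exists>e \<in> H. ends F e \<inter> verts C \<noteq> {}"
  have W: "summand F (wedge F X H) X" by (rule wedge_summand[OF F X])
  have v: "verts X \<subseteq> verts (wedge F X H)"
  proof
    fix v assume "v \<in> verts X"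
    then obtain C where "C \<in> components F X" "v \<in> verts C"
      using vertex_in_component[OF F X] by blast
    then show "v \<in> verts (wedge F X H)" using all by (auto simp: wedge_def hunion_def)
  qed
  have "e \<in> hedges (wedge F X H)" if "e \<in> hedges X" for e
  proof -
    have "ends F e \<subseteq> verts X" "ends F e \<noteq> {}"
      using that X ends_nonempty[OF F] by (auto simp: hypergraphs_def)
    then show ?thesis using W v that unfolding summand_def by blast
  qed
  then show "X = wedge F X H"
    using v W by (intro hypergraph.expand) (auto simp: summand_def subhypergraph_def)
qed

section \<open>Effect of hyperedge addition and deletion\<close>

text \<open>
  \<open>H\<close> is finite here: the finitely many subsets of \<open>verts X\<close> each underlie finitely many
  hyperedges.
\<close>
lemma boxplus_hypergraph:
  assumes F: "hypergraph_family loops F" and X: "X \<in> hypergraphs F" and H: "H \<subseteq> elabels F"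
    and sup: "supp F H \<subseteq> verts X"
  shows "boxplus X H \<in> hypergraphs F"
proof -
  let ?\<A> = "{A. A \<subseteq> verts X \<and> admissible loops A}"
  have VX: "verts X \<subseteq> vlabels F" "finite (verts X)" using X by (auto simp: hypergraphs_def)
  have "finite (\<Union>A \<in> ?\<A>. {e \<in> elabels F. ends F e = A})"
    using VX F by (intro finite_UN_I) (auto simp: hypergraph_family_def)
  moreover have "H \<subseteq> (\<Union>A \<in> ?\<A>. {e \<in> elabels F. ends F e = A})"
  proof
    fix e assume e: "e \<in> H"
    then have "e \<in> elabels F" "ends F e \<subseteq> verts X" using H sup by blast+
    moreover have "admissible loops (ends F e)"
      using F \<open>e \<in> elabels F\<close> by (simp add: hypergraph_family_def)
    ultimately show "e \<in> (\<Union>A \<in> ?\<A>. {e \<in> elabels F. ends F e = A})" by simp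
  qed
  ultimately have "finite H" by (rule rev_finite_subset)
  then show ?thesis using X H sup by (auto simp: hypergraphs_def boxplus_def)
qed

text \<open>
  A hyperedge lies in exactly one of \<open>X\<close> and \<open>boxplus X H\<close> if it belongs to \<open>H\<close>. Hence if it
  touches a summand of both, it would have to lie in that summand, and so in both.
\<close>
lemma components_boxplus:
  assumes F: "hypergraph_family loops F" and X: "X \<in> hypergraphs F" and H: "H \<subseteq> elabels F"
    and sup: "supp F H \<subseteq> verts X" and C: "C \<in> components F X"
  shows "C \<in> components F (boxplus X H) \<longleftrightarrow> \<not> (\<exists>e \<in> H. ends F e \<inter> verts C \<noteq> {})"
proof -
  have B: "boxplus X H \<in> hypergraphs F" by (rule boxplus_hypergraph[OF F X H sup])
  have con: "connected F C" and CX: "summand F C X"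
    using C components_iff_summand[OF F X] by auto
  have hC: "C \<in> hypergraphs F" using CX by (simp add: summand_def)
  have "summand F C (boxplus X H) \<longleftrightarrow> \<not> (\<exists>e \<in> H. ends F e \<inter> verts C \<noteq> {})"
  proof
    assume CB: "summand F C (boxplus X H)"
    show "\<not> (\<exists>e \<in> H. ends F e \<inter> verts C \<noteq> {})"
    proof
      assume "\<exists>e \<in> H. ends F e \<inter> verts C \<noteq> {}"
      then obtain e where e: "e \<in> H" "ends F e \<inter> verts C \<noteq> {}" by blast
      then have "e \<in> hedges X \<or> e \<in> hedges (boxplus X H)" by (auto simp: boxplus_def)
      then have "e \<in> hedges C" using CX CB e(2) by (auto simp: summand_def)
      then have "e \<in> hedges X" "e \<in> hedges (boxplus X H)"
        using CX CB by (auto simp: summand_def subhypergraph_def)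
      then show False using e(1) by (simp add: boxplus_def)
    qed
  next
    assume miss: "\<not> (\<exists>e \<in> H. ends F e \<inter> verts C \<noteq> {})"
    have "e \<notin> H" if "e \<in> hedges C" for e
    proof -
      have "ends F e \<subseteq> verts C" "ends F e \<noteq> {}"
        using that hC ends_nonempty[OF F] by (auto simp: hypergraphs_def)
      then show ?thesis using miss by blast
    qed
    then show "summand F C (boxplus X H)"
      using CX miss unfolding summand_def subhypergraph_def boxplus_def by auto
  qed
  then show ?thesis using con components_iff_summand[OF F B] by blast
qed

text \<open>
  The two summands account for every change because a hyperedge of \<open>H\<close> that already belongs to \<open>X\<close>
  lies in \<open>wedge F X H\<close>, so nothing is deleted from the remainder.
\<close>
lemma boxplus_direct_sum:
  assumes F: "hypergraph_family loops F" and X: "X \<in> hypergraphs F" and H: "H \<subseteq> elabels F"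
    and sup: "supp F H \<subseteq> verts X"
  shows "is_direct_sum (boxplus X H) (ddiff F X (wedge F X H)) (boxplus (wedge F X H) H)"
proof -
  let ?W = "wedge F X H"
  have W: "summand F ?W X" by (rule wedge_summand[OF F X])
  have sub: "verts ?W \<subseteq> verts X" "hedges ?W \<subseteq> hedges X"
    using W by (auto simp: summand_def subhypergraph_def)
  have "e \<in> hedges ?W" if "e \<in> H" "e \<in> hedges X" for e
  proof -
    have "ends F e \<subseteq> verts ?W" "ends F e \<noteq> {}"
      using that H supp_subset_wedge[OF F X sup] ends_nonempty[OF F] by auto
    then show ?thesis using W that unfolding summand_def by blast
  qed
  then show ?thesis
    using sub unfolding ddiff_summand[OF F X W] is_direct_sum_def vdisjoint_def hunion_def boxplus_def
    by auto
qed

section \<open>The transformation and its distinguished hypergraphs\<close>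

theorem proposition3p23:
  fixes loops :: bool
    and F :: "('v, 'e) family"
    and H :: "'e set"
    and \<X> \<S> :: "('v, 'e) hypergraph set"
    and \<pi> :: "('v, 'e) hypergraph \<Rightarrow> ('v, 'e) hypergraph"
    and \<D> :: "('v, 'e) hypergraph \<Rightarrow> ('v, 'e) hypergraph set"
  assumes "hypergraph_family loops F"
    and "H \<subseteq> elabels F" and "H \<noteq> {}"
    and "\<X> \<subseteq> hypergraphs F" and "H_closed F H \<X>"
    and "\<And>X. X \<in> \<X> \<Longrightarrow> \<pi> X = (if supp F H \<subseteq> verts X then boxplus X H else X)"
    and "\<S> = {S \<in> \<X>. supp F H \<subseteq> verts S \<and> S = wedge F S H}"
    and "\<And>X. X \<in> \<X> \<Longrightarrow> \<D> X = (if supp F H \<subseteq> verts X then {wedge F X H} else {})"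
  shows "hypergraph_transformation_with F \<X> \<pi> \<S> \<D> \<and>
    (\<forall>\<S>' \<subseteq> \<X>. hypergraph_transformation F \<X> \<pi> \<S>' \<longrightarrow> \<S>' \<subseteq> \<S>)"
proof -
  note F = assms(1) and H = assms(2) and pi = assms(6) and S_def = assms(7) and D = assms(8)
  have hyp: "X \<in> hypergraphs F" if "X \<in> \<X>" for X using that assms(4) by blast
  obtain e\<^sub>0 where e\<^sub>0: "e\<^sub>0 \<in> H" using assms(3) by blast
  then have supp_ne: "supp F H \<noteq> {}" using ends_nonempty[OF F] H by blast
  have WS: "wedge F X H \<in> \<S>" if "X \<in> \<X>" "supp F H \<subseteq> verts X" for X
    using that assms(5) supp_subset_wedge[OF F hyp] wedge_wedge[OF F hyp]
    unfolding S_def H_closed_def by simp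
  have null_S: "null \<notin> \<S>" using supp_ne by (auto simp: S_def null_def)
  have mapsto: "\<pi> \<in> \<X> \<rightarrow> hypergraphs F"
    using pi hyp boxplus_hypergraph[OF F hyp H] by auto
  have nonredundant: "cdisjoint F S (\<pi> S)" if "S \<in> \<S>" for S
  proof -
    have S: "S \<in> \<X>" "supp F H \<subseteq> verts S" "S = wedge F S H" using that by (auto simp: S_def)
    then have "\<forall>C \<in> components F S. \<exists>e \<in> H. ends F e \<inter> verts C \<noteq> {}"
      using wedge_eq_self_iff[OF F hyp] by blast
    then show ?thesis
      using components_boxplus[OF F hyp H S(2)] S(1,2) pi unfolding cdisjoint_def by auto
  qed
  have maximal: "maximal_subset F \<S> X (\<D> X)" if X: "X \<in> \<X>" for X
  proof (cases "supp F H \<subseteq> verts X")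
    case True
    have "components F S \<subseteq> components F (wedge F X H)"
      if S: "S \<in> \<S>" and sub: "components F S \<subseteq> components F X" for S
    proof -
      have "S \<in> \<X>" "S = wedge F S H" using S by (auto simp: S_def)
      then have "\<forall>C \<in> components F S. \<exists>e \<in> H. ends F e \<inter> verts C \<noteq> {}"
        using wedge_eq_self_iff[OF F hyp] by blast
      then show ?thesis using sub components_wedge[OF F hyp[OF X]] by auto
    qed
    then show ?thesis
      using True D[OF X] WS[OF X True] null_S components_wedge[OF F hyp[OF X]]
      by (auto simp: maximal_subset_def pairwise_def)
  next
    case False
    have "\<not> components F S \<subseteq> components F X" if "S \<in> \<S>" for S
      using that verts_mono_components[OF F hyp, of S X] False by (auto simp: S_def)
    then show ?thesis using False D[OF X] null_S by (auto simp: maximal_subset_def)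
  qed
  have sum: "let R = replaced F \<pi> (\<D> X) X in
        pairwise vdisjoint (\<pi> ` R) \<and> card (\<pi> ` R) = card R \<and>
        is_direct_sum (\<pi> X) (ddiff F X (hunion R)) (hunion (\<pi> ` R))" if X: "X \<in> \<X>" for X
  proof (cases "supp F H \<subseteq> verts X")
    case True
    let ?W = "wedge F X H"
    have "?W \<in> \<X>" "supp F H \<subseteq> verts ?W" using WS[OF X True] by (auto simp: S_def)
    then have piW: "\<pi> ?W = boxplus ?W H" using pi by simp
    have "verts (\<pi> ?W) \<inter> verts (ddiff F X ?W) = {}"
      unfolding piW ddiff_summand[OF F hyp[OF X] wedge_summand[OF F hyp[OF X]]]
      by (auto simp: boxplus_def)
    then have R: "replaced F \<pi> (\<D> X) X = {?W}" using D[OF X] True by (auto simp: replaced_def)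
    have single: "hunion {A} = A" for A :: "('v, 'e) hypergraph"
      by (cases A) (simp add: hunion_def)
    show ?thesis
      using boxplus_direct_sum[OF F hyp[OF X] H True] pi[OF X] True
      by (simp add: R single piW pairwise_def)
  next
    case False
    then have R: "replaced F \<pi> (\<D> X) X = {}" using D[OF X] by (simp add: replaced_def)
    have "hunion {} = (null :: ('v, 'e) hypergraph)" by (simp add: hunion_def null_def)
    moreover have "ddiff F X null = X"
      unfolding ddiff_summand[OF F hyp[OF X] null_summand] by (cases X) (simp add: null_def)
    moreover have "is_direct_sum X X null"
      by (cases X) (simp add: is_direct_sum_def vdisjoint_def hunion_def null_def)
    ultimately show ?thesis using pi[OF X] False by (simp add: R pairwise_def)
  qed
  have "\<S> \<subseteq> \<X>" by (auto simp: S_def)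
  then have transf: "hypergraph_transformation_with F \<X> \<pi> \<S> \<D>"
    unfolding hypergraph_transformation_with_def component_maximal_def
    using assms(4) mapsto nonredundant null_S maximal sum by blast
  have "S \<in> \<S>" if S': "\<S>' \<subseteq> \<X>" "hypergraph_transformation F \<X> \<pi> \<S>'" and S: "S \<in> \<S>'" for \<S>' S
  proof -
    have dis: "cdisjoint F S (\<pi> S)" and nonnull: "null \<in> \<S>' \<Longrightarrow> \<pi> null \<noteq> null"
      using S'(2) S unfolding hypergraph_transformation_def hypergraph_transformation_with_def
      by blast+
    have SX: "S \<in> \<X>" using S' S by blast
    have sup: "supp F H \<subseteq> verts S"
    proof (rule ccontr)
      assume "\<not> supp F H \<subseteq> verts S"
      then have fixed: "\<pi> S = S" using pi[OF SX] by simp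
      then have "components F S = {}" using dis by (simp add: cdisjoint_def)
      then have "verts S = {}" using vertex_in_component[OF F hyp[OF SX]] by blast
      then have "S = null" using null_iff_verts_empty[OF F hyp[OF SX]] by blast
      then show False using fixed nonnull S by blast
    qed
    have "\<forall>C \<in> components F S. C \<notin> components F (boxplus S H)"
      using dis pi[OF SX] sup by (auto simp: cdisjoint_def)
    then have "S = wedge F S H"
      using wedge_eq_self_iff[OF F hyp[OF SX]] components_boxplus[OF F hyp[OF SX] H sup] by blast
    then show ?thesis using SX sup by (simp add: S_def)
  qed
  then show ?thesis using transf by blast
qed

end
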